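(* Let $m,n$ be positive integers, $A\in\mathbb{Z}^{m\times n^2}$, $b\in\mathbb{Z}^m$, $\unlhd\in\{=,\le\}^m$, $s\in\mathbb{R}^n$, and $y\in\mathbb{R}^n$. Put $C=ys^T$ and let $X^*$ be an optimal solution of the linear program $$\text{maximize } \operatorname{trace}(C^TX)\quad\text{subject to } X\in\mathbb{R}^{n\times n},\ X\ge 0,\ X\mathbf{1}=\mathbf{1},\ \mathbf{1}^TX=\mathbf{1}^T,\ A\,\mathrm{vec}(X)\unlhd b .$$ If $X^*$ is integral (all entries are integers), then $X^*s$ is a solution of the minimum distance decoding problem $$\text{minimize } \|y-x\|^2\quad\text{subject to } x\in\Lambda(A,b,\unlhd,s).$$
   Context: $\Pi_n$ is the set of $n\times n$ permutation matrices. $\mathrm{vec}(X)=(X_{1,1},\dots,X_{1,n},X_{2,1},\dots,X_{2,n},\dots,X_{n,n})^T\in\mathbb{R}^{n^2}$ is the row-by-row vectorization. For $\unlhd=(\unlhd_1,\dots,\unlhd_m)$ with each $\unlhd_i$ either $=$ or $\le$, $u\unlhd v$ for $u,v\in\mathbb{R}^m$ means $u_i\unlhd_i v_i$ for all $i$. Define $\Pi(A,b,\unlhd)=\{X\in\Pi_n : A\,\mathrm{vec}(X)\unlhd b\}$ and the LP decodable permutation code $\Lambda(A,b,\unlhd,s)=\{Xs : X\in\Pi(A,b,\unlhd)\}$. $\mathbf{1}$ is the all-one column vector, $X\ge0$ is entrywise, $\|\cdot\|$ is the Euclidean norm. *)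

theory Defs
  imports
    "HOL-Analysis.L2_Norm"
    "HOL-Combinatorics.Permutations"
    "Jordan_Normal_Form.Matrix"
begin

text \<open>Matrices and vectors are those of \<^theory>\<open>Jordan_Normal_Form.Matrix\<close>, so all indices start
  at 0.\<close>

definition perm_mats :: "nat \<Rightarrow> real mat set" where
  "perm_mats n = {mat n n (\<lambda>(i, j). if j = p i then 1 else 0) | p. p permutes {..<n}}"

definition ones :: "nat \<Rightarrow> real vec" where
  "ones n = vec n (\<lambda>_. 1)"

definition mat_trace :: "real mat \<Rightarrow> real" where
  "mat_trace M = (\<Sum>i<dim_row M. M $$ (i, i))"

definition outer_prod :: "real vec \<Rightarrow> real vec \<Rightarrow> real mat" where
  "outer_prod u v = mat (dim_vec u) (dim_vec v) (\<lambda>(i, j). u $ i * v $ j)"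

definition euclid_norm :: "real vec \<Rightarrow> real" where
  "euclid_norm v = L2_set (\<lambda>i. v $ i) {..<dim_vec v}"

text \<open>Row-by-row vectorization: entry \<open>(i, j)\<close> is placed at position \<open>i * dim_col X + j\<close>.\<close>

definition vectorize :: "real mat \<Rightarrow> real vec" where
  "vectorize X = vec (dim_row X * dim_col X) (\<lambda>k. X $$ (k div dim_col X, k mod dim_col X))"

text \<open>A vector \<open>R\<close> of relation symbols is represented by a vector of relations on the reals.\<close>

definition rel_symbols :: "nat \<Rightarrow> (real \<Rightarrow> real \<Rightarrow> bool) vec set" where
  "rel_symbols m = {R \<in> carrier_vec m. \<forall>i<m. R $ i \<in> {(=), (\<le>)}}"

definition rel_holds :: "(real \<Rightarrow> real \<Rightarrow> bool) vec \<Rightarrow> real vec \<Rightarrow> real vec \<Rightarrow> bool" where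
  "rel_holds R u v \<longleftrightarrow> (\<forall>i<dim_vec R. (R $ i) (u $ i) (v $ i))"

definition satisfies_constraints ::
    "int mat \<Rightarrow> int vec \<Rightarrow> (real \<Rightarrow> real \<Rightarrow> bool) vec \<Rightarrow> real mat \<Rightarrow> bool" where
  "satisfies_constraints A b R X \<longleftrightarrow>
     rel_holds R (map_mat real_of_int A *\<^sub>v vectorize X) (map_vec real_of_int b)"

definition constrained_perm_mats ::
    "nat \<Rightarrow> int mat \<Rightarrow> int vec \<Rightarrow> (real \<Rightarrow> real \<Rightarrow> bool) vec \<Rightarrow> real mat set" where
  "constrained_perm_mats n A b R = {X \<in> perm_mats n. satisfies_constraints A b R X}"

definition lp_decodable_code ::
    "nat \<Rightarrow> int mat \<Rightarrow> int vec \<Rightarrow> (real \<Rightarrow> real \<Rightarrow> bool) vec \<Rightarrow> real vec \<Rightarrow> real vec set" where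
  "lp_decodable_code n A b R s = {X *\<^sub>v s | X. X \<in> constrained_perm_mats n A b R}"

text \<open>On matrices \<open>\<le>\<close> is entrywise.\<close>

definition lp_feasible ::
    "nat \<Rightarrow> int mat \<Rightarrow> int vec \<Rightarrow> (real \<Rightarrow> real \<Rightarrow> bool) vec \<Rightarrow> real mat \<Rightarrow> bool" where
  "lp_feasible n A b R X \<longleftrightarrow>
     X \<in> carrier_mat n n \<and>
     0\<^sub>m n n \<le> X \<and>
     X *\<^sub>v ones n = ones n \<and>
     mat_of_row (ones n) * X = mat_of_row (ones n) \<and>
     satisfies_constraints A b R X"

end

theory Submission
  imports Defs
begin

text \<open>An integral nonnegative matrix with unit row and column sums is a permutation matrix, so \<open>X\<close>
  is a codeword matrix. All codewords have the same norm as \<open>s\<close>, hence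
  \<open>\<parallel>y - Z s\<parallel>\<^sup>2 = \<parallel>y\<parallel>\<^sup>2 + \<parallel>s\<parallel>\<^sup>2 - 2 \<langle>y, Z s\<rangle>\<close> for every permutation matrix \<open>Z\<close>, and the linear
  objective \<open>trace (C\<^sup>T Z)\<close> is exactly \<open>\<langle>y, Z s\<rangle>\<close>. So maximizing over the larger feasible set of
  the linear program minimizes the distance.\<close>

lemma mult_mat_vec_ones_eq_iff:
  assumes "X \<in> carrier_mat n n"
  shows "X *\<^sub>v ones n = ones n \<longleftrightarrow> (\<forall>i<n. (\<Sum>j<n. X $$ (i, j)) = 1)"
  using assms by (auto simp: vec_eq_iff ones_def scalar_prod_def atLeast0LessThan)

lemma ones_row_mult_mat_eq_iff:
  assumes "X \<in> carrier_mat n n"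
  shows "mat_of_row (ones n) * X = mat_of_row (ones n) \<longleftrightarrow> (\<forall>j<n. (\<Sum>i<n. X $$ (i, j)) = 1)"
  using assms by (auto simp: mat_eq_iff ones_def scalar_prod_def atLeast0LessThan)

lemma zero_mat_le_iff:
  fixes X :: "real mat"
  assumes "X \<in> carrier_mat n n"
  shows "0\<^sub>m n n \<le> X \<longleftrightarrow> (\<forall>i<n. \<forall>j<n. 0 \<le> X $$ (i, j))"
  using assms by (auto simp: less_eq_mat_def)

text \<open>Identifies the feasible set with the doubly stochastic matrices that meet the side
  constraints, in terms of entries.\<close>

lemma lp_feasible_iff:
  "lp_feasible n A b R X \<longleftrightarrow> X \<in> carrier_mat n n \<and> (\<forall>i<n. \<forall>j<n. 0 \<le> X $$ (i, j)) \<and>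
     (\<forall>i<n. (\<Sum>j<n. X $$ (i, j)) = 1) \<and> (\<forall>j<n. (\<Sum>i<n. X $$ (i, j)) = 1) \<and>
     satisfies_constraints A b R X"
  by (auto simp: lp_feasible_def mult_mat_vec_ones_eq_iff ones_row_mult_mat_eq_iff zero_mat_le_iff)

text \<open>Lets every codeword matrix compete in the linear program: row \<open>i\<close> has its
  only 1 in column \<open>p i\<close>, and bijectivity of \<open>p\<close> gives each column exactly
  one 1.\<close>

lemma perm_mat_feasible:
  assumes "X \<in> constrained_perm_mats n A b R"
  shows "lp_feasible n A b R X"
proof -
  from assms obtain p where p: "p permutes {..<n}"
    and X: "X = mat n n (\<lambda>(i, j). if j = p i then 1 else 0)"
    and con: "satisfies_constraints A b R X"
    by (auto simp: constrained_perm_mats_def perm_mats_def)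
  have "(\<Sum>j<n. X $$ (i, j)) = 1" if "i < n" for i
  proof -
    have "p i < n" using permutes_in_image[OF p, of i] that by simp
    with that show ?thesis by (simp add: X)
  qed
  moreover have "(\<Sum>i<n. X $$ (i, j)) = 1" if "j < n" for j
  proof -
    \<comment> \<open>The summand is put as a function of \<open>p i\<close> so that the sum can be
      reindexed along \<open>p\<close>.\<close>
    have "(\<Sum>i<n. X $$ (i, j)) = (\<Sum>i<n. (\<lambda>k. if j = k then 1 else 0) (p i))"
      using that by (simp add: X)
    also have "\<dots> = (\<Sum>k<n. if j = k then 1 else 0)"
      by (rule sum.reindex_bij_betw[OF permutes_imp_bij[OF p]])
    finally show ?thesis using that by simp
  qed
  ultimately show ?thesis using con by (auto simp: lp_feasible_iff X)
qed

text \<open>Some term is nonzero, and being a nonnegative integer it is at least 1. It uses up the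
  whole total, so the other nonnegative terms vanish.\<close>

lemma sum_eq_one_Ints_unique:
  fixes f :: "'a \<Rightarrow> real"
  assumes "finite S" and nonneg: "\<And>i. i \<in> S \<Longrightarrow> 0 \<le> f i" and int: "\<And>i. i \<in> S \<Longrightarrow> f i \<in> \<int>"
    and sum: "sum f S = 1"
  obtains k where "k \<in> S" "\<And>i. i \<in> S \<Longrightarrow> f i = (if i = k then 1 else 0)"
proof -
  have "\<exists>k\<in>S. f k \<noteq> 0" using sum by (metis sum.neutral zero_neq_one)
  then obtain k where k: "k \<in> S" "f k \<noteq> 0" by blast
  have "1 \<le> f k"
    using Ints_nonzero_abs_ge1[OF int[OF k(1)] k(2)] nonneg[OF k(1)] by simp
  moreover have split: "sum f S = f k + sum f (S - {k})"
    by (rule sum.remove[OF assms(1) k(1)])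
  moreover have "0 \<le> sum f (S - {k})" by (rule sum_nonneg) (simp add: nonneg)
  ultimately have "f k = 1" "sum f (S - {k}) = 0" using sum by linarith+
  moreover from this(2) have "f i = 0" if "i \<in> S - {k}" for i
    using that assms(1) nonneg by (subst (asm) sum_nonneg_eq_0_iff) auto
  ultimately show ?thesis using k(1) by (intro that[of k]) auto
qed

text \<open>The row sums put a single 1 in each row \<open>i\<close>, at column \<open>q i\<close>;
  the column sums make \<open>q\<close> injective, hence a bijection of the finite set
  \<open>{..<n}\<close>.\<close>

lemma integral_feasible_in_constrained_perm_mats:
  assumes feas: "lp_feasible n A b R X" and int: "elements_mat X \<subseteq> \<int>"
  shows "X \<in> constrained_perm_mats n A b R"
proof -
  from feas have car: "X \<in> carrier_mat n n"
    and nonneg: "\<And>i j. i < n \<Longrightarrow> j < n \<Longrightarrow> 0 \<le> X $$ (i, j)"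
    and row: "\<And>i. i < n \<Longrightarrow> (\<Sum>j<n. X $$ (i, j)) = 1"
    and col: "\<And>j. j < n \<Longrightarrow> (\<Sum>i<n. X $$ (i, j)) = 1"
    and con: "satisfies_constraints A b R X"
    by (auto simp: lp_feasible_iff)
  have ent: "X $$ (i, j) \<in> \<int>" if "i < n" "j < n" for i j
    using int elements_matI[OF car that refl] by blast
  have "\<exists>k<n. \<forall>j<n. X $$ (i, j) = (if j = k then 1 else 0)" if "i < n" for i
    using sum_eq_one_Ints_unique[of "{..<n}" "\<lambda>j. X $$ (i, j)"] nonneg ent row that
    by (metis finite_lessThan lessThan_iff)
  then obtain q where q: "\<And>i. i < n \<Longrightarrow> q i < n"
    "\<And>i j. i < n \<Longrightarrow> j < n \<Longrightarrow> X $$ (i, j) = (if j = q i then 1 else 0)"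
    by metis
  have inj: "inj_on q {..<n}"
  proof (rule inj_onI)
    fix i i' assume i: "i \<in> {..<n}" "i' \<in> {..<n}" and eq: "q i = q i'"
    \<comment> \<open>Column \<open>q i\<close> has its only 1 in row \<open>k\<close>, but rows
      \<open>i\<close> and \<open>i'\<close> both have a 1 there.\<close>
    obtain k where "\<And>l. l < n \<Longrightarrow> X $$ (l, q i) = (if l = k then 1 else 0)"
      using sum_eq_one_Ints_unique[of "{..<n}" "\<lambda>l. X $$ (l, q i)"] nonneg ent col q(1) i
      by (metis finite_lessThan lessThan_iff)
    then have "i = k" "i' = k" using q i eq by (metis lessThan_iff zero_neq_one)+
    then show "i = i'" by simp
  qed
  \<comment> \<open>\<open>permutes\<close> requires the identity outside \<open>{..<n}\<close>,
    where \<open>q\<close> is arbitrary.\<close>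
  define p where "p i = (if i < n then q i else i)" for i
  have "inj_on p {..<n}" using inj by (simp add: p_def inj_on_def)
  moreover have "p ` {..<n} \<subseteq> {..<n}" using q(1) by (auto simp: p_def)
  ultimately have "bij_betw p {..<n} {..<n}"
    by (simp add: bij_betw_def endo_inj_surj)
  then have "p permutes {..<n}" by (rule bij_imp_permutes) (simp add: p_def)
  moreover have "X = mat n n (\<lambda>(i, j). if j = p i then 1 else 0)"
    using car q(2) by (intro eq_matI) (auto simp: p_def)
  ultimately show ?thesis using con by (auto simp: constrained_perm_mats_def perm_mats_def)
qed

text \<open>By cyclicity, trace(s y^T Z) = y^T Z s; in coordinates this is an exchange of two finite
  sums.\<close>

lemma mat_trace_outer_prod:
  assumes "y \<in> carrier_vec n" "s \<in> carrier_vec n" "Z \<in> carrier_mat n n"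
  shows "mat_trace (transpose_mat (outer_prod y s) * Z) = (\<Sum>i<n. y $ i * (Z *\<^sub>v s) $ i)"
proof -
  have "mat_trace (transpose_mat (outer_prod y s) * Z)
      = (\<Sum>j<n. \<Sum>i<n. y $ i * s $ j * Z $$ (i, j))"
    using assms by (simp add: mat_trace_def outer_prod_def scalar_prod_def atLeast0LessThan)
  also have "\<dots> = (\<Sum>i<n. \<Sum>j<n. y $ i * s $ j * Z $$ (i, j))" by (rule sum.swap)
  also have "\<dots> = (\<Sum>i<n. y $ i * (Z *\<^sub>v s) $ i)"
    using assms by (simp add: scalar_prod_def atLeast0LessThan sum_distrib_left mult_ac)
  finally show ?thesis .
qed

text \<open>Coordinate \<open>i\<close> of the product is \<open>s $ p i\<close>, so
  \<open>Z\<close> only rearranges the summands.\<close>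

lemma perm_mat_mult_vec_sum_squares:
  assumes "Z \<in> perm_mats n" "s \<in> carrier_vec n"
  shows "(\<Sum>i<n. ((Z *\<^sub>v s) $ i)\<^sup>2) = (\<Sum>i<n. (s $ i)\<^sup>2)"
proof -
  from assms obtain p where p: "p permutes {..<n}"
    and Z: "Z = mat n n (\<lambda>(i, j). if j = p i then 1 else 0)"
    by (auto simp: perm_mats_def)
  have "(Z *\<^sub>v s) $ i = s $ p i" if "i < n" for i
  proof -
    have "p i < n" using permutes_in_image[OF p, of i] that by simp
    then show ?thesis
      using assms that
      by (simp add: Z scalar_prod_def atLeast0LessThan if_distrib[of "\<lambda>c. c * _"] cong: if_cong)
  qed
  then have "(\<Sum>i<n. ((Z *\<^sub>v s) $ i)\<^sup>2) = (\<Sum>i<n. (s $ p i)\<^sup>2)" by simp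
  also have "\<dots> = (\<Sum>i<n. (s $ i)\<^sup>2)"
    by (rule sum.reindex_bij_betw[OF permutes_imp_bij[OF p]])
  finally show ?thesis .
qed

lemma euclid_norm_diff_perm_mat_mult:
  assumes "Z \<in> perm_mats n" "s \<in> carrier_vec n" "y \<in> carrier_vec n"
  shows "(euclid_norm (y - Z *\<^sub>v s))\<^sup>2 = (\<Sum>i<n. (y $ i)\<^sup>2) + (\<Sum>i<n. (s $ i)\<^sup>2)
     - 2 * mat_trace (transpose_mat (outer_prod y s) * Z)"
proof -
  have Z: "Z \<in> carrier_mat n n" using assms(1) by (auto simp: perm_mats_def)
  have "(euclid_norm (y - Z *\<^sub>v s))\<^sup>2 = (\<Sum>i<n. (y $ i - (Z *\<^sub>v s) $ i)\<^sup>2)"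
    using Z by (simp add: euclid_norm_def L2_set_def sum_nonneg del: index_mult_mat_vec)
  also have "\<dots> = (\<Sum>i<n. (y $ i)\<^sup>2) + (\<Sum>i<n. ((Z *\<^sub>v s) $ i)\<^sup>2)
      - 2 * (\<Sum>i<n. y $ i * (Z *\<^sub>v s) $ i)"
    by (simp add: power2_diff sum.distrib sum_subtractf sum_distrib_left mult.assoc
        del: index_mult_mat_vec)
  finally show ?thesis
    using perm_mat_mult_vec_sum_squares[OF assms(1,2)] mat_trace_outer_prod[OF assms(3,2) Z] by simp
qed

theorem mainTheorem2:
  fixes m n :: nat
    and A :: "int mat" and b :: "int vec"
    and R :: "(real \<Rightarrow> real \<Rightarrow> bool) vec"
    and s y :: "real vec"
    and C X :: "real mat"
  assumes "m > 0" and "n > 0"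
    and "A \<in> carrier_mat m (n\<^sup>2)"
    and "b \<in> carrier_vec m"
    and "R \<in> rel_symbols m"
    and "s \<in> carrier_vec n"
    and "y \<in> carrier_vec n"
    and "C = outer_prod y s"
    and "is_arg_max (\<lambda>Z. mat_trace (transpose_mat C * Z)) (lp_feasible n A b R) X"
    and "elements_mat X \<subseteq> \<int>"
  shows "is_arg_min (\<lambda>x. (euclid_norm (y - x))\<^sup>2) (\<lambda>x. x \<in> lp_decodable_code n A b R s) (X *\<^sub>v s)"
proof -
  \<comment> \<open>An optimal solution is in particular feasible, so integrality makes it a
    permutation matrix.\<close>
  have X: "X \<in> constrained_perm_mats n A b R"
    using assms(9,10) by (auto simp: is_arg_max_def intro: integral_feasible_in_constrained_perm_mats)
  have dist: "(euclid_norm (y - Z *\<^sub>v s))\<^sup>2 = (\<Sum>i<n. (y $ i)\<^sup>2) + (\<Sum>i<n. (s $ i)\<^sup>2)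
      - 2 * mat_trace (transpose_mat C * Z)" if "Z \<in> constrained_perm_mats n A b R" for Z
    using euclid_norm_diff_perm_mat_mult[of Z n s y] that assms(6-8)
    by (simp add: constrained_perm_mats_def)
  have "(euclid_norm (y - X *\<^sub>v s))\<^sup>2 \<le> (euclid_norm (y - Z *\<^sub>v s))\<^sup>2"
    if Z: "Z \<in> constrained_perm_mats n A b R" for Z
  proof -
    \<comment> \<open>\<open>is_arg_max\<close> excludes strictly larger values at feasible points,
      and \<open>Z\<close> is one; linearity of the order turns this into \<le>.\<close>
    have "mat_trace (transpose_mat C * Z) \<le> mat_trace (transpose_mat C * X)"
      using assms(9) perm_mat_feasible[OF Z] by (auto simp: is_arg_max_def not_less)
    then show ?thesis using dist[OF X] dist[OF Z] by simp
  qed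
  then show ?thesis
    using X by (auto simp: is_arg_min_def lp_decodable_code_def not_less)
qed

end
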